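(* Let $X\subset\mathbb{P}^3$ be an irreducible reduced surface of degree $d\geq 3$ over $\mathbb{C}$, and let $\Lambda$ be a line on $X$, not contained in $\mathrm{Sing}(X)$, such that all smooth points of $X$ contained in $\Lambda$ are star points of $X$. If $\mathrm{Sing}(X)\cap\Lambda$ consists of $d-1$ pairwise different points, then each of these $d-1$ points is an $A_{d-1}$-singularity of $X$.
   Context: The ground field is $\mathbb{C}$, and $\mathrm{Sing}(X)$ is the singular locus of $X$. A smooth point $P$ of an irreducible reduced surface $X\subset\mathbb{P}^3$ of degree $d\geq 3$ is called a star point on $X$ if the scheme $T_P(X)\cap X$ is a cone with vertex $P$, where $T_P(X)$ is the embedded tangent plane to $X$ at $P$; that is, in homogeneous coordinates $(Y_0:Y_1:Y_2)$ on $T_P(X)$ with $P=(1:0:0)$, the scheme $T_P(X)\cap X$ is defined by a form of degree $d$ not involving $Y_0$. A point $P$ of a surface $X\subset\mathbb{P}^3$ is an $A_k$-singularity ($k\geq 1$) if in suitable local analytic coordinates $(z_1,z_2,z_3)$ of $\mathbb{P}^3$ centered at $P$ the surface $X$ has equation $z_1^2+z_2^2+z_3^{k+1}=0$. *)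

theory Defs
  imports
    "HOL-Analysis.Analysis"
    "HOL-Computational_Algebra.Factorial_Ring"
    "HOL-Library.Poly_Mapping"
begin

text \<open>
  Polynomials over the complex numbers whose variables are indexed by \<open>'n\<close>; a polynomial maps
  exponent vectors to coefficients.  The homogeneous coordinate ring of projective 3-space is
  \<open>4 cpoly\<close>, that of a plane is \<open>3 cpoly\<close>.
\<close>

type_synonym 'n cpoly = "('n \<Rightarrow>\<^sub>0 nat) \<Rightarrow>\<^sub>0 complex"

definition poly_subst ::
    "(complex \<Rightarrow> 'b) \<Rightarrow> ('n::finite \<Rightarrow> 'b) \<Rightarrow> 'n cpoly \<Rightarrow> 'b::comm_semiring_1" where
  "poly_subst h f p =
     (\<Sum>m\<in>Poly_Mapping.keys p. h (Poly_Mapping.lookup p m) * (\<Prod>i\<in>UNIV. f i ^ Poly_Mapping.lookup m i))"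

definition poly_eval :: "'n::finite cpoly \<Rightarrow> complex^'n \<Rightarrow> complex" where
  "poly_eval p v = poly_subst (\<lambda>c. c) (\<lambda>i. v $ i) p"

definition partial_deriv :: "'n \<Rightarrow> 'n cpoly \<Rightarrow> 'n cpoly" where
  "partial_deriv i p =
     (\<Sum>m\<in>Poly_Mapping.keys p.
        Poly_Mapping.single (m - Poly_Mapping.single i 1)
          (of_nat (Poly_Mapping.lookup m i) * Poly_Mapping.lookup p m))"

definition form :: "nat \<Rightarrow> 'n::finite cpoly \<Rightarrow> bool" where
  "form d p \<longleftrightarrow>
     p \<noteq> 0 \<and> (\<forall>m\<in>Poly_Mapping.keys p. (\<Sum>i\<in>UNIV. Poly_Mapping.lookup m i) = d)"

definition vars :: "'n cpoly \<Rightarrow> 'n set" where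
  "vars p = (\<Union>m\<in>Poly_Mapping.keys p. Poly_Mapping.keys m)"

text \<open>
  The form on the linear subspace spanned by the vectors \<open>b j\<close> obtained from a form \<open>p\<close> on the
  ambient space by substituting \<open>x = (\<Sum>j. Y\<^sub>j b\<^sub>j)\<close>.
\<close>

definition restrict_form :: "('k::finite \<Rightarrow> complex^'n) \<Rightarrow> 'n::finite cpoly \<Rightarrow> 'k cpoly" where
  "restrict_form b p =
     poly_subst (Poly_Mapping.single 0)
       (\<lambda>i. \<Sum>j\<in>UNIV. Poly_Mapping.single (Poly_Mapping.single j 1) (b j $ i)) p"

text \<open>
  A point of projective space is a one-dimensional linear subspace; the points of the
  projectivisation of a linear subspace \<open>W\<close> are the points contained in \<open>W\<close>.
\<close>

definition proj :: "(complex^'n) set \<Rightarrow> (complex^'n) set set" where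
  "proj W = {P. vec.subspace P \<and> vec.dim P = 1 \<and> P \<subseteq> W}"

definition proj_line :: "(complex^'n) set set \<Rightarrow> bool" where
  "proj_line \<Lambda> \<longleftrightarrow> (\<exists>W. vec.subspace W \<and> vec.dim W = 2 \<and> \<Lambda> = proj W)"

text \<open>
  A surface of degree \<open>d\<close> is given by a form \<open>F\<close> of degree \<open>d\<close>, unique up to a nonzero factor; it is
  an integral (irreducible and reduced) scheme iff \<open>F\<close> is an irreducible polynomial.
\<close>

definition integral_surface :: "nat \<Rightarrow> 4 cpoly \<Rightarrow> bool" where
  "integral_surface d F \<longleftrightarrow> form d F \<and> irreducible F"

definition surface_points :: "4 cpoly \<Rightarrow> (complex^4) set set" where
  "surface_points F = {P \<in> proj UNIV. \<forall>v\<in>P. poly_eval F v = 0}"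

definition Sing :: "4 cpoly \<Rightarrow> (complex^4) set set" where
  "Sing F = {P \<in> surface_points F. \<forall>v\<in>P - {0}. \<forall>i. poly_eval (partial_deriv i F) v = 0}"

text \<open>The linear subspace whose projectivisation is the embedded tangent plane (\<open>P\<close> smooth).\<close>

definition tangent_plane :: "4 cpoly \<Rightarrow> (complex^4) set \<Rightarrow> (complex^4) set" where
  "tangent_plane F P =
     {w. \<forall>v\<in>P - {0}. (\<Sum>i\<in>UNIV. poly_eval (partial_deriv i F) v * w $ i) = 0}"

text \<open>
  The coordinates \<open>(Y\<^sub>0 : Y\<^sub>1 : Y\<^sub>2)\<close> on the tangent plane are those with respect to the basis
  \<open>b 0, b 1, b 2\<close>, so \<open>P = (1 : 0 : 0)\<close>.  The scheme-theoretic plane section is defined by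
  \<open>restrict_form b F\<close>, and every other form of degree \<open>d\<close> defining it is a nonzero constant multiple
  of this one.
\<close>

definition star_point :: "nat \<Rightarrow> 4 cpoly \<Rightarrow> (complex^4) set \<Rightarrow> bool" where
  "star_point d F P \<longleftrightarrow>
     P \<in> surface_points F - Sing F \<and>
     (\<exists>b :: 3 \<Rightarrow> complex^4.
        vec.span {b 0} = P \<and> vec.span (range b) = tangent_plane F P \<and>
        form d (restrict_form b F) \<and> 0 \<notin> vars (restrict_form b F))"

text \<open>
  Holomorphic functions of several variables: complex differentiable, i.e. differentiable with
  complex linear derivative, at every point of an open set.
\<close>

definition holo_on :: "(complex^'n \<Rightarrow> complex) \<Rightarrow> (complex^'n) set \<Rightarrow> bool" where
  "holo_on f U \<longleftrightarrow>
     open U \<and>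
     (\<forall>x\<in>U. \<exists>D. (f has_derivative D) (at x) \<and> (\<forall>c w. D (c *s w) = c * D w))"

definition holo_map_on :: "(complex^'n \<Rightarrow> complex^'m) \<Rightarrow> (complex^'n) set \<Rightarrow> bool" where
  "holo_map_on f U \<longleftrightarrow> (\<forall>j. holo_on (\<lambda>x. f x $ j) U)"

definition centered_coords :: "(complex^3 \<Rightarrow> complex^3) \<Rightarrow> (complex^3) set \<Rightarrow> bool" where
  "centered_coords z U \<longleftrightarrow>
     0 \<in> U \<and> z 0 = 0 \<and> inj_on z U \<and>
     holo_map_on z U \<and> holo_map_on (inv_into U z) (z ` U)"

text \<open>
  If \<open>v, b 1, b 2, b 3\<close> is a basis, then \<open>y \<mapsto> [v + \<Sum>j. y\<^sub>j b\<^sub>j]\<close> is an affine chart of projective 3-space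
  with \<open>P = [v]\<close> at the origin; \<open>z\<close> is an analytic coordinate system on a neighbourhood \<open>U\<close> of the
  origin in this chart.  The surface has the stated equation in the sense of ideals: its
  dehomogenised equation and the normal form differ by a nowhere vanishing holomorphic factor \<open>e\<close>.
\<close>

definition A_singularity :: "nat \<Rightarrow> 4 cpoly \<Rightarrow> (complex^4) set \<Rightarrow> bool" where
  "A_singularity k F P \<longleftrightarrow>
     k \<ge> 1 \<and> P \<in> surface_points F \<and>
     (\<exists>(v :: complex^4) (b :: 3 \<Rightarrow> complex^4) U z e.
        vec.span {v} = P \<and> vec.span (insert v (range b)) = UNIV \<and>
        centered_coords z U \<and> holo_on e U \<and>
        (\<forall>y\<in>U. e y \<noteq> 0 \<and>
           poly_eval F (v + (\<Sum>j\<in>UNIV. y $ j *s b j)) =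
             e y * ((z y $ 1)\<^sup>2 + (z y $ 2)\<^sup>2 + (z y $ 3) ^ (k + 1))))"

end

theory Submission
  imports Defs "HOL-Computational_Algebra.Polynomial"
begin

text \<open>
  The partial derivatives of \<open>F\<close> restrict to \<open>\<Lambda>\<close> as forms of degree \<open>d - 1\<close> with the same \<open>d - 1\<close> zeros,
  so they are constant multiples \<open>c\<^sub>i M\<close> of one form \<open>M\<close> with simple zeros, and the plane
  \<open>l = (\<Sum>i. c\<^sub>i x\<^sub>i) = 0\<close> is tangent along \<open>\<Lambda>\<close>.  The star points make \<open>F\<close> on this plane invariant under
  translation along \<open>\<Lambda>\<close>, hence a nonzero multiple of the \<open>d\<close>-th power of a linear form \<open>x\<close>.  Thus
  \<open>F = l Q + r x^d\<close> where \<open>Q\<close> restricts to \<open>M\<close> on \<open>\<Lambda>\<close>.  At a singular point the zero of \<open>M\<close> is simple,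
  so \<open>l, Q, x\<close> are local coordinates, in which \<open>l Q + r x^d\<close> is the \<open>A\<^bsub>d-1\<^esub>\<close> equation.
\<close>

section \<open>Evaluation of polynomials\<close>

abbreviation "lookup \<equiv> Poly_Mapping.lookup"
abbreviation "keys \<equiv> Poly_Mapping.keys"

definition monom_eval :: "('n::finite \<Rightarrow>\<^sub>0 nat) \<Rightarrow> complex^'n \<Rightarrow> complex" where
  "monom_eval m v = (\<Prod>i\<in>UNIV. v $ i ^ lookup m i)"

lemma monom_eval_add: "monom_eval (m + n) v = monom_eval m v * monom_eval n v"
  by (simp add: monom_eval_def lookup_add power_add prod.distrib)

lemma monom_eval_0 [simp]: "monom_eval 0 v = 1"
  by (simp add: monom_eval_def)

lemma poly_eval_keys: "poly_eval p v = (\<Sum>m\<in>keys p. lookup p m * monom_eval m v)"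
  by (simp add: poly_eval_def poly_subst_def monom_eval_def)

lemma poly_eval_superset:
  assumes "finite A" "keys p \<subseteq> A"
  shows "poly_eval p v = (\<Sum>m\<in>A. lookup p m * monom_eval m v)"
  unfolding poly_eval_keys using assms by (intro sum.mono_neutral_left) (auto simp: in_keys_iff)

lemma poly_eval_0 [simp]: "poly_eval 0 v = 0"
  by (simp add: poly_eval_keys)

lemma poly_eval_single [simp]: "poly_eval (Poly_Mapping.single m c) v = c * monom_eval m v"
  by (subst poly_eval_superset[where A = "{m}"]) auto

lemma poly_eval_add: "poly_eval (p + q) v = poly_eval p v + poly_eval q v"
proof -
  let ?A = "keys p \<union> keys q"
  have "keys (p + q) \<subseteq> ?A"
    by (rule keys_add)
  then show ?thesis
    by (simp add: poly_eval_superset[where A = ?A] lookup_add ring_distribs sum.distrib)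
qed

lemma poly_eval_sum: "poly_eval (sum f A) v = (\<Sum>a\<in>A. poly_eval (f a) v)"
  by (induction A rule: infinite_finite_induct) (auto simp: poly_eval_add)

lemma poly_mapping_sum_single:
  fixes p :: "'a \<Rightarrow>\<^sub>0 'b::comm_monoid_add"
  shows "p = (\<Sum>m\<in>keys p. Poly_Mapping.single m (lookup p m))"
  by (rule poly_mapping_eqI) (auto simp: lookup_sum lookup_single when_def in_keys_iff)

lemma poly_eval_mult: "poly_eval (p * q) v = poly_eval p v * poly_eval q v"
proof -
  have "p * q = (\<Sum>m\<in>keys p. \<Sum>n\<in>keys q. Poly_Mapping.single (m + n) (lookup p m * lookup q n))"
    by (subst (1) poly_mapping_sum_single[of p], subst (1) poly_mapping_sum_single[of q])
      (simp add: sum_product mult_single)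
  then show ?thesis
    by (simp add: poly_eval_sum monom_eval_add poly_eval_keys[of p] poly_eval_keys[of q] sum_product ac_simps)
qed

lemma poly_eval_1 [simp]: "poly_eval 1 v = 1"
  using poly_eval_single[of 0 1 v] by simp

lemma poly_eval_power: "poly_eval (p ^ k) v = poly_eval p v ^ k"
  by (induction k) (auto simp: poly_eval_mult)

lemma poly_eval_prod: "poly_eval (prod f A) v = (\<Prod>a\<in>A. poly_eval (f a) v)"
  by (induction A rule: infinite_finite_induct) (auto simp: poly_eval_mult)

lemma monom_eval_single:
  "monom_eval (Poly_Mapping.single j k) v = v $ j ^ k"
proof -
  have "monom_eval (Poly_Mapping.single j k) v = (\<Prod>i\<in>UNIV. if i = j then v $ j ^ k else 1)"
    unfolding monom_eval_def by (intro prod.cong) (auto simp: lookup_single when_def)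
  then show ?thesis by simp
qed

text \<open>Evaluation respects sums and products, so formal substitution becomes composition with
  the parametrisation of the subspace. Star points can thus be studied through values of
  \<open>F\<close>.\<close>

lemma poly_eval_restrict_form:
  "poly_eval (restrict_form b p) y = poly_eval p (\<Sum>j\<in>UNIV. y $ j *s b j)"
  by (simp add: restrict_form_def poly_subst_def poly_eval_sum poly_eval_mult poly_eval_prod
      poly_eval_power monom_eval_single poly_eval_keys[of p])
    (simp add: monom_eval_def mult.commute)

lemma poly_eval_cong_vars:
  assumes "\<And>i. i \<in> vars p \<Longrightarrow> v $ i = w $ i"
  shows "poly_eval p v = poly_eval p w"
  unfolding poly_eval_keys monom_eval_def
proof (intro sum.cong prod.cong refl arg_cong2[where f = "(*)"])
  fix m i assume "m \<in> keys p"
  then show "v $ i ^ lookup m i = w $ i ^ lookup m i"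
  proof (cases "i \<in> keys m")
    case True
    then have "i \<in> vars p"
      using \<open>m \<in> keys p\<close> by (auto simp only: vars_def)
    then show ?thesis
      using assms by simp
  qed (simp add: in_keys_iff)
qed

lemma poly_eval_homogeneous:
  assumes "\<And>m. m \<in> keys p \<Longrightarrow> (\<Sum>i\<in>UNIV. lookup m i) = N"
  shows "poly_eval p (a *s v) = a ^ N * poly_eval p v"
proof -
  have "monom_eval m (a *s v) = a ^ N * monom_eval m v" if "m \<in> keys p" for m
    using assms[OF that]
    by (simp add: monom_eval_def power_mult_distrib prod.distrib power_sum[symmetric])
  then show ?thesis
    unfolding poly_eval_keys by (simp add: sum_distrib_left ac_simps)
qed

text \<open>Each variable becomes a linear polynomial in \<open>t\<close>, so a monomial of total
  degree at most \<open>N\<close> contributes degree at most \<open>N\<close>. This bound allows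
  zeros on a line to be counted.\<close>

lemma poly_eval_along_line:
  assumes "\<And>m. m \<in> keys p \<Longrightarrow> (\<Sum>i\<in>UNIV. lookup m i) \<le> N"
  obtains g :: "complex poly" where "degree g \<le> N" "\<And>t. poly g t = poly_eval p (v + t *s w)"
proof
  let ?M = "\<lambda>m. smult (lookup p m) (\<Prod>i\<in>UNIV. [:v $ i, w $ i:] ^ lookup m i)"
  show "degree (\<Sum>m\<in>keys p. ?M m) \<le> N"
  proof (intro degree_sum_le finite_keys)
    fix m assume m: "m \<in> keys p"
    have deg: "degree ([:v $ i, w $ i:] ^ lookup m i) \<le> lookup m i" for i
      using degree_power_le[of "[:v $ i, w $ i:]" "lookup m i"]
      by (auto split: if_splits)
    have "degree (?M m) \<le> degree (\<Prod>i\<in>UNIV. [:v $ i, w $ i:] ^ lookup m i)"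
      by (rule degree_smult_le)
    also have "\<dots> \<le> (\<Sum>i\<in>UNIV. degree ([:v $ i, w $ i:] ^ lookup m i))"
      using degree_prod_sum_le[of UNIV "\<lambda>i. [:v $ i, w $ i:] ^ lookup m i"] by (simp add: o_def)
    also have "\<dots> \<le> (\<Sum>i\<in>UNIV. lookup m i)"
      by (intro sum_mono deg)
    also have "\<dots> \<le> N" by (rule assms[OF m])
    finally show "degree (?M m) \<le> N" .
  qed
  show "poly (\<Sum>m\<in>keys p. ?M m) t = poly_eval p (v + t *s w)" for t
    by (simp add: poly_sum poly_prod poly_eval_keys monom_eval_def algebra_simps)
qed

section \<open>Partial derivatives\<close>

lemma keys_partial_deriv:
  assumes "n \<in> keys (partial_deriv i p)"
  obtains m where "m \<in> keys p" "lookup m i > 0" "n = m - Poly_Mapping.single i 1"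
proof -
  have "n \<in> (\<Union>m\<in>keys p. keys (Poly_Mapping.single (m - Poly_Mapping.single i 1)
      (of_nat (lookup m i) * lookup p m)))"
    using subsetD[OF keys_sum assms[unfolded partial_deriv_def]] .
  then show thesis
    using that by (auto split: if_splits)
qed

text \<open>Only monomials containing the variable \<open>i\<close> survive, and each loses exactly
  one degree; \<open>Suc\<close> keeps truncated subtraction out of the statement.\<close>

lemma degree_partial_deriv:
  assumes "n \<in> keys (partial_deriv i p)"
  obtains m where "m \<in> keys p" "Suc (\<Sum>j\<in>UNIV. lookup n j) = (\<Sum>j\<in>UNIV. lookup m (j::'n::finite))"
proof -
  obtain m where m: "m \<in> keys p" "lookup m i > 0" "n = m - Poly_Mapping.single i 1"
    using keys_partial_deriv[OF assms] .
  have "m = n + Poly_Mapping.single i 1"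
    using m(2,3) by (intro poly_mapping_eqI) (auto simp: lookup_add lookup_minus lookup_single when_def)
  then have "(\<Sum>j\<in>UNIV. lookup m j) = (\<Sum>j\<in>UNIV. lookup n j + (if j = i then 1 else 0))"
    by (auto simp: lookup_add lookup_single when_def intro!: sum.cong)
  then show thesis
    using that[OF m(1)] by (simp add: sum.distrib)
qed

lemma lookup_partial_deriv:
  "lookup (partial_deriv i p) m
    = of_nat (Suc (lookup m i)) * lookup p (m + Poly_Mapping.single i 1)"
proof -
  let ?e = "Poly_Mapping.single i (1::nat)"
  \<comment> \<open>For \<open>lookup n i = 0\<close> the truncated difference \<open>n - ?e\<close>
    is \<open>n\<close> itself and the equivalence can fail; such terms carry the coefficient 0
    anyway.\<close>
  have eq: "n - ?e = m \<longleftrightarrow> n = m + ?e" if "lookup n i \<noteq> 0" for n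
  proof
    show "n = m + ?e" if "n - ?e = m"
      using \<open>lookup n i \<noteq> 0\<close> unfolding that[symmetric]
      by (intro poly_mapping_eqI) (auto simp: lookup_add lookup_minus lookup_single when_def)
  qed auto
  have "lookup (partial_deriv i p) m
      = (\<Sum>n\<in>keys p. if n - ?e = m then of_nat (lookup n i) * lookup p n else 0)"
    by (simp add: partial_deriv_def lookup_sum lookup_single when_def)
  also have "\<dots> = (\<Sum>n\<in>keys p. if n = m + ?e then of_nat (lookup n i) * lookup p n else 0)"
  proof (intro sum.cong refl)
    fix n
    show "(if n - ?e = m then of_nat (lookup n i) * lookup p n else 0)
      = (if n = m + ?e then of_nat (lookup n i) * lookup p n else 0)"
      using eq[of n] by (cases "lookup n i = 0") auto
  qed
  also have "\<dots> = of_nat (lookup (m + ?e) i) * lookup p (m + ?e)"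
    by (auto simp: in_keys_iff)
  finally show ?thesis
    by (simp add: lookup_add)
qed

lemma has_derivative_monom_eval:
  "(monom_eval m has_derivative
     (\<lambda>w. \<Sum>i\<in>UNIV. of_nat (lookup m i) * monom_eval (m - Poly_Mapping.single i 1) v * w $ i)) (at v)"
proof -
  have coord: "((\<lambda>x. x $ i) has_derivative (\<lambda>w. w $ i)) (at v)" for i
    by (rule bounded_linear_imp_has_derivative) (rule bounded_linear_vec_nth)
  \<comment> \<open>Both sides truncate in the same way when \<open>lookup m i = 0\<close>, so no
    case distinction is needed.\<close>
  have me: "monom_eval (m - Poly_Mapping.single i 1) v
      = v $ i ^ (lookup m i - 1) * (\<Prod>j\<in>UNIV - {i}. v $ j ^ lookup m j)" for i
    unfolding monom_eval_def by (subst prod.remove[of _ i])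
      (auto simp: lookup_minus lookup_single when_def intro!: prod.cong)
  have "((\<lambda>x. \<Prod>i\<in>UNIV. x $ i ^ lookup m i) has_derivative
      (\<lambda>w. \<Sum>i\<in>UNIV. (of_nat (lookup m i) * w $ i * v $ i ^ (lookup m i - 1))
        * (\<Prod>j\<in>UNIV - {i}. v $ j ^ lookup m j))) (at v)"
    by (intro has_derivative_prod has_derivative_power coord)
  then show ?thesis
    unfolding me by (simp add: monom_eval_def[abs_def] ac_simps)
qed

lemma poly_eval_partial_deriv:
  "poly_eval (partial_deriv i p) v
    = (\<Sum>m\<in>keys p. lookup p m * (of_nat (lookup m i) * monom_eval (m - Poly_Mapping.single i 1) v))"
  by (simp add: partial_deriv_def poly_eval_sum ac_simps)

lemma has_derivative_poly_eval:
  "(poly_eval p has_derivative (\<lambda>w. \<Sum>i\<in>UNIV. poly_eval (partial_deriv i p) v * w $ i)) (at v)"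
proof -
  have "((\<lambda>x. \<Sum>m\<in>keys p. lookup p m * monom_eval m x) has_derivative
      (\<lambda>w. \<Sum>m\<in>keys p. lookup p m *
        (\<Sum>i\<in>UNIV. of_nat (lookup m i) * monom_eval (m - Poly_Mapping.single i 1) v * w $ i))) (at v)"
    by (intro has_derivative_sum has_derivative_mult_right has_derivative_monom_eval)
  also have "(\<lambda>w. \<Sum>m\<in>keys p. lookup p m *
        (\<Sum>i\<in>UNIV. of_nat (lookup m i) * monom_eval (m - Poly_Mapping.single i 1) v * w $ i))
     = (\<lambda>w. \<Sum>i\<in>UNIV. poly_eval (partial_deriv i p) v * w $ i)"
    unfolding poly_eval_partial_deriv sum_distrib_left sum_distrib_right
    by (subst sum.swap) (simp add: ac_simps)
  finally show ?thesis
    by (simp add: poly_eval_keys[abs_def])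
qed

lemma poly_eval_partial_deriv_eq_0:
  assumes "\<And>v. poly_eval p v = 0"
  shows "poly_eval (partial_deriv i p) v = 0"
proof -
  have "((\<lambda>v. 0) has_derivative (\<lambda>w. \<Sum>i\<in>UNIV. poly_eval (partial_deriv i p) v * w $ i)) (at v)"
    using has_derivative_poly_eval[of p v] by (simp only: ext[of "poly_eval p" "\<lambda>_. 0", OF assms])
  then have "(\<lambda>w. \<Sum>i\<in>UNIV. poly_eval (partial_deriv i p) v * w $ i) = (\<lambda>w. 0)"
    by (rule has_derivative_unique) simp
  from fun_cong[OF this, of "axis i 1"] show ?thesis
    by (simp add: axis_def if_distrib cong: if_cong)
qed

text \<open>Induction on a degree bound: if the function vanishes, so do its partial derivatives as
  functions, hence as polynomials by induction. Then \<open>p\<close> is constant, and its value at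
  0 is 0.\<close>

lemma poly_eval_eq_0_imp_eq_0:
  assumes "\<And>v. poly_eval p v = 0"
  shows "p = 0"
proof -
  have "p = 0" if "\<And>m. m \<in> keys p \<Longrightarrow> (\<Sum>i\<in>UNIV. lookup m i) \<le> N" "\<And>v. poly_eval p v = 0"
    for N :: nat and p :: "'a cpoly"
    using that
  proof (induction N arbitrary: p rule: less_induct)
    case (less N)
    have dp: "partial_deriv i p = 0" for i
    proof (cases N)
      case 0
      have "n \<notin> keys (partial_deriv i p)" for n
      proof
        assume "n \<in> keys (partial_deriv i p)"
        then obtain m where "m \<in> keys p" "Suc (\<Sum>j\<in>UNIV. lookup n j) = (\<Sum>j\<in>UNIV. lookup m j)"
          by (rule degree_partial_deriv)
        then show False
          using less.prems(1)[of m] 0 by simp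
      qed
      then show ?thesis
        by (simp flip: keys_eq_empty add: set_eq_iff)
    next
      case (Suc N')
      show ?thesis
      proof (rule less.IH)
        show "N' < N" by (simp add: Suc)
        show "poly_eval (partial_deriv i p) v = 0" for v
          using less.prems(2) by (rule poly_eval_partial_deriv_eq_0)
        show "(\<Sum>j\<in>UNIV. lookup n j) \<le> N'" if "n \<in> keys (partial_deriv i p)" for n
        proof -
          obtain m where "m \<in> keys p" "Suc (\<Sum>j\<in>UNIV. lookup n j) = (\<Sum>j\<in>UNIV. lookup m j)"
            using degree_partial_deriv[OF \<open>n \<in> keys (partial_deriv i p)\<close>] .
          then show ?thesis
            using less.prems(1)[of m] Suc by simp
        qed
      qed
    qed
    \<comment> \<open>In characteristic 0 the factor \<open>Suc (lookup ?n i)\<close> cancels, so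
      vanishing partial derivatives leave only the constant term.\<close>
    have nz: "lookup p m = 0" if m: "lookup m i \<noteq> 0" for m i
    proof -
      let ?n = "m - Poly_Mapping.single i 1"
      have "?n + Poly_Mapping.single i 1 = m"
        using m by (intro poly_mapping_eqI) (auto simp: lookup_add lookup_minus lookup_single when_def)
      then have "of_nat (Suc (lookup ?n i)) * lookup p m = 0"
        using lookup_partial_deriv[of i p ?n] dp[of i] by simp
      then show ?thesis
        by (simp del: of_nat_Suc)
    qed
    have "m = 0" if "m \<in> keys p" for m
      using nz that by (intro poly_mapping_eqI) (auto simp: in_keys_iff)
    then have p: "p = Poly_Mapping.single 0 (lookup p 0)"
      using nz by (intro poly_mapping_eqI) (auto simp: lookup_single when_def in_keys_iff)
    have "poly_eval p 0 = lookup p 0"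
      by (subst p) simp
    then show "p = 0"
      using less.prems(2) p by simp
  qed
  from this[of p "\<Sum>m\<in>keys p. \<Sum>i\<in>UNIV. lookup m i"] show ?thesis
    using assms by (simp add: member_le_sum[where f = "\<lambda>m. \<Sum>i\<in>UNIV. lookup m i"])
qed

section \<open>Polynomial functions\<close>

text \<open>Generating the functions inductively, instead of through exponents, gives splitting,
  differentiation and continuity by rule induction and makes affine substitution harmless.\<close>

inductive polyfun :: "(complex^'n \<Rightarrow> complex) \<Rightarrow> bool" where
  const: "polyfun (\<lambda>x. c)"
| coord: "polyfun (\<lambda>x. x $ i)"
| add: "polyfun f \<Longrightarrow> polyfun g \<Longrightarrow> polyfun (\<lambda>x. f x + g x)"
| mult: "polyfun f \<Longrightarrow> polyfun g \<Longrightarrow> polyfun (\<lambda>x. f x * g x)"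

lemma polyfun_sum: "(\<And>a. a \<in> A \<Longrightarrow> polyfun (f a)) \<Longrightarrow> polyfun (\<lambda>x. \<Sum>a\<in>A. f a x)"
  by (induction A rule: infinite_finite_induct) (auto intro: polyfun.intros)

lemma polyfun_prod: "(\<And>a. a \<in> A \<Longrightarrow> polyfun (f a)) \<Longrightarrow> polyfun (\<lambda>x. \<Prod>a\<in>A. f a x)"
  by (induction A rule: infinite_finite_induct) (auto intro: polyfun.intros)

lemma polyfun_power: "polyfun f \<Longrightarrow> polyfun (\<lambda>x. f x ^ k)"
  by (induction k) (auto intro: polyfun.intros)

lemma polyfun_poly_eval:
  assumes "\<And>i. polyfun (\<lambda>x. f x $ i)"
  shows "polyfun (\<lambda>x. poly_eval p (f x))"
  unfolding poly_eval_keys monom_eval_def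
  by (intro polyfun_sum polyfun.mult polyfun.const polyfun_prod polyfun_power assms)

text \<open>Division with remainder by the coordinate \<open>x $ i\<close>; the remainder is
  \<open>f\<close> on the hyperplane where this coordinate is 0.\<close>

lemma polyfun_split:
  assumes "polyfun f"
  obtains q where "polyfun q" "\<And>x. f x = f (\<chi> j. if j = i then 0 else x $ j) + x $ i * q x"
proof -
  define z :: "complex^'a \<Rightarrow> complex^'a" where "z x = (\<chi> j. if j = i then 0 else x $ j)" for x
  \<comment> \<open>The third conjunct strengthens the induction: the quotient of a product contains
    the factor \<open>f (z x)\<close>, which must itself be polynomial.\<close>
  have "\<exists>q. polyfun q \<and> (\<forall>x. f x = f (z x) + x $ i * q x) \<and> polyfun (\<lambda>x. f (z x))"
    using assms
  proof induction
    case (const c)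
    then show ?case
      by (intro exI[of _ "\<lambda>x. 0"]) (auto intro: polyfun.const)
  next
    case (coord j)
    show ?case
    proof (cases "j = i")
      case True
      then show ?thesis
        by (intro exI[of _ "\<lambda>x. 1"]) (auto simp: z_def intro: polyfun.const)
    next
      case False
      then show ?thesis
        by (intro exI[of _ "\<lambda>x. 0"]) (auto simp: z_def intro: polyfun.intros)
    qed
  next
    case (add f g)
    then obtain q r where q: "polyfun q" "\<And>x. f x = f (z x) + x $ i * q x" "polyfun (\<lambda>x. f (z x))"
      and r: "polyfun r" "\<And>x. g x = g (z x) + x $ i * r x" "polyfun (\<lambda>x. g (z x))"
      by blast
    have "f x + g x = f (z x) + g (z x) + x $ i * (q x + r x)" for x
      by (subst q(2)[of x], subst r(2)[of x]) (simp only: algebra_simps)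
    then show ?case
      by (intro exI[of _ "\<lambda>x. q x + r x"] conjI allI polyfun.add q(1,3) r(1,3))
  next
    case (mult f g)
    then obtain q r where q: "polyfun q" "\<And>x. f x = f (z x) + x $ i * q x" "polyfun (\<lambda>x. f (z x))"
      and r: "polyfun r" "\<And>x. g x = g (z x) + x $ i * r x" "polyfun (\<lambda>x. g (z x))"
      by blast
    have "f x * g x = f (z x) * g (z x) + x $ i * (q x * g x + f (z x) * r x)" for x
    proof -
      have "f x * g x = f (z x) * g x + x $ i * q x * g x"
        by (subst q(2)[of x]) (simp only: algebra_simps)
      also have "f (z x) * g x = f (z x) * (g (z x) + x $ i * r x)"
        by (subst r(2)[of x]) (rule refl)
      finally show ?thesis
        by (simp only: algebra_simps)
    qed
    then show ?case
      by (intro exI[of _ "\<lambda>x. q x * g x + f (z x) * r x"] conjI allI polyfun.add polyfun.mult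
          mult.hyps q(1,3) r(1,3))
  qed
  then show thesis
    using that unfolding z_def by blast
qed

text \<open>The partial derivatives are again polynomial, hence continuous, which the inverse
  function theorem requires.\<close>

lemma polyfun_has_derivative:
  assumes "polyfun f"
  obtains g where "\<And>i. polyfun (g i)"
    "\<And>x. (f has_derivative (\<lambda>w. \<Sum>i\<in>UNIV. g i x * w $ i)) (at x)"
proof -
  have "\<exists>g. (\<forall>i. polyfun (g i)) \<and> (\<forall>x. (f has_derivative (\<lambda>w. \<Sum>i\<in>UNIV. g i x * w $ i)) (at x))"
    using assms
  proof induction
    case (const c)
    then show ?case
      by (intro exI[of _ "\<lambda>i x. 0"]) (auto intro: polyfun.const)
  next
    case (coord j)
    have "((\<lambda>x. x $ j) has_derivative (\<lambda>w. w $ j)) (at x)" for x :: "complex^'a"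
      by (rule bounded_linear_imp_has_derivative) (rule bounded_linear_vec_nth)
    then show ?case
      by (intro exI[of _ "\<lambda>i x. if i = j then 1 else 0"])
        (auto intro: polyfun.const simp: if_distrib[of "\<lambda>x. x * _"] cong: if_cong)
  next
    case (add f g)
    then obtain f' g' where *: "\<And>i. polyfun (f' i)" "\<And>i. polyfun (g' i)"
      "\<And>x. (f has_derivative (\<lambda>w. \<Sum>i\<in>UNIV. f' i x * w $ i)) (at x)"
      "\<And>x. (g has_derivative (\<lambda>w. \<Sum>i\<in>UNIV. g' i x * w $ i)) (at x)"
      by blast
    show ?case
      using has_derivative_add[OF *(3,4)]
      by (intro exI[of _ "\<lambda>i x. f' i x + g' i x"])
        (auto intro: polyfun.add * simp: ring_distribs sum.distrib)
  next
    case (mult f g)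
    then obtain f' g' where *: "\<And>i. polyfun (f' i)" "\<And>i. polyfun (g' i)"
      "\<And>x. (f has_derivative (\<lambda>w. \<Sum>i\<in>UNIV. f' i x * w $ i)) (at x)"
      "\<And>x. (g has_derivative (\<lambda>w. \<Sum>i\<in>UNIV. g' i x * w $ i)) (at x)"
      by blast
    show ?case
      using has_derivative_mult[OF *(3,4)] mult.hyps
      by (intro exI[of _ "\<lambda>i x. f x * g' i x + f' i x * g x"])
        (auto intro!: polyfun.add polyfun.mult * simp: ring_distribs sum.distrib
          sum_distrib_left sum_distrib_right ac_simps)
  qed
  then show thesis
    using that by blast
qed

lemma polyfun_continuous: "polyfun f \<Longrightarrow> continuous_on S f"
  by (induction rule: polyfun.induct) (intro continuous_intros; assumption)+

section \<open>Holomorphic coordinates from polynomial maps\<close>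

lemma polyfun_holo_on:
  assumes "polyfun f" "open U"
  shows "holo_on f U"
proof -
  obtain g where "\<And>i. polyfun (g i)"
    and "\<And>x. (f has_derivative (\<lambda>w. \<Sum>i\<in>UNIV. g i x * w $ i)) (at x)"
    using polyfun_has_derivative[OF assms(1)] by metis
  moreover have "(\<Sum>i\<in>UNIV. g i x * (c *s w) $ i) = c * (\<Sum>i\<in>UNIV. g i x * w $ i)" for x c and w :: "complex^'a"
    by (simp add: sum_distrib_left ac_simps)
  ultimately show ?thesis
    unfolding holo_on_def using assms(2) by blast
qed

lemma has_derivative_vec:
  fixes f :: "complex^'n \<Rightarrow> complex^'m"
  assumes "\<And>j. ((\<lambda>x. f x $ j) has_derivative (\<lambda>w. D w $ j)) (at x)"
  shows "(f has_derivative D) (at x)"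
  unfolding has_derivative_componentwise_within[of f]
proof
  fix b :: "complex^'m" assume "b \<in> Basis"
  \<comment> \<open>The real basis vectors are complex axes with entry 1 or the imaginary unit, so
    real components reduce to complex ones.\<close>
  then obtain j c where b: "b = axis j c"
    by (auto simp: Basis_vec_def)
  have "((\<lambda>x. f x $ j \<bullet> c) has_derivative (\<lambda>w. D w $ j \<bullet> c)) (at x)"
    by (intro has_derivative_inner_left assms)
  then show "((\<lambda>x. f x \<bullet> b) has_derivative (\<lambda>w. D w \<bullet> b)) (at x)"
    by (simp add: b inner_axis)
qed

text \<open>The real inverse function theorem applies, since an injective derivative is invertible
  in finite dimension. The derivative of the local inverse inverts a complex linear map, so the
  inverse is holomorphic.\<close>

lemma centered_coords_polyfun:
  fixes z :: "complex^3 \<Rightarrow> complex^3"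
  assumes pf: "\<And>j. polyfun (\<lambda>x. z x $ j)"
    and z0: "z 0 = 0"
    and der: "(z has_derivative D) (at 0)"
    and inj: "\<And>w. D w = 0 \<Longrightarrow> w = 0"
  obtains U where "centered_coords z U" "open U"
proof -
  have "\<forall>j. \<exists>g. (\<forall>i. polyfun (g i)) \<and>
      (\<forall>x. ((\<lambda>x. z x $ j) has_derivative (\<lambda>w. \<Sum>i\<in>UNIV. g i x * w $ i)) (at x))"
    by (rule allI, rule polyfun_has_derivative[OF pf]) blast
  from choice[OF this] obtain G where G: "\<And>i j. polyfun (G j i)"
    "\<And>x j. ((\<lambda>x. z x $ j) has_derivative (\<lambda>w. \<Sum>i\<in>UNIV. G j i x * w $ i)) (at x)"
    by blast
  define D' where "D' x w = (\<chi> j. \<Sum>i\<in>UNIV. G j i x * w $ i)" for x and w :: "complex^3"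
  have zD': "(z has_derivative D' x) (at x)" for x
    by (rule has_derivative_vec) (simp add: D'_def G)
  have bl: "bounded_linear (D' x)" for x
    using zD' by (rule has_derivative_bounded_linear)
  \<comment> \<open>The theorem needs the derivative as a point of the operator space, depending
    continuously on \<open>x\<close>; continuity is checked on each argument vector.\<close>
  define B where "B x = Blinfun (D' x)" for x
  have B: "blinfun_apply (B x) = D' x" for x
    unfolding B_def by (rule bounded_linear_Blinfun_apply[OF bl])
  have "D = D' 0"
    using der zD' by (rule has_derivative_unique)
  have "continuous_on UNIV B"
  proof (rule continuous_on_blinfun_componentwise)
    fix b :: "complex^3"
    show "continuous_on UNIV (\<lambda>x. blinfun_apply (B x) b)"
      unfolding B D'_def by (intro continuous_intros polyfun_continuous G)
  qed
  have "inj (D' 0)"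
    unfolding linear_injective_0[OF bounded_linear.linear[OF bl]]
    using inj \<open>D = D' 0\<close> by blast
  then obtain g where g: "linear g" "g \<circ> D' 0 = id"
    using linear_injective_left_inverse[OF bounded_linear.linear[OF bl]] by blast
  have invf: "Blinfun g o\<^sub>L B 0 = id_blinfun"
    by (rule blinfun_eqI)
      (use g(1) in \<open>simp add: B bounded_linear_Blinfun_apply linear_conv_bounded_linear
        fun_cong[OF g(2), simplified]\<close>)
  obtain U V h h' where U: "open U" "0 \<in> U" "open V" "homeomorphism U V z h"
    and h: "\<And>y. y \<in> V \<Longrightarrow> (h has_derivative (h' y)) (at y)"
    and h': "\<And>y. y \<in> V \<Longrightarrow> h' y = inv (blinfun_apply (B (h y)))"
    and bij: "\<And>y. y \<in> V \<Longrightarrow> bij (blinfun_apply (B (h y)))"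
  proof (rule inverse_function_theorem[of UNIV z B 0 "Blinfun g"])
    show "(z has_derivative blinfun_apply (B x)) (at x)" for x
      unfolding B by (rule zD')
  qed (simp_all add: invf \<open>continuous_on UNIV B\<close>)
  have inj_z: "inj_on z U"
    by (rule inj_on_inverseI[of _ h]) (rule homeomorphism_apply1[OF U(4)])
  have zU: "z ` U = V"
    using U(4) by (simp add: homeomorphism_def)
  have inv_z: "inv_into U z y = h y" if "y \<in> V" for y
    by (rule inv_into_f_eq[OF inj_z])
      (use that homeomorphism_image2[OF U(4)] homeomorphism_apply2[OF U(4)] in auto)
  have "holo_on (\<lambda>y. inv_into U z y $ j) V" for j
    unfolding holo_on_def
  proof (intro conjI ballI)
    fix y assume y: "y \<in> V"
    have "((\<lambda>y. h y $ j) has_derivative (\<lambda>w. h' y w $ j)) (at y)"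
      using bounded_linear.has_derivative[OF bounded_linear_vec_nth h[OF y]] .
    then have "((\<lambda>y. inv_into U z y $ j) has_derivative (\<lambda>w. h' y w $ j)) (at y)"
      by (rule has_derivative_transform_within_open[OF _ U(3) y]) (simp add: inv_z)
    \<comment> \<open>The Jacobian \<open>D' (h y)\<close> commutes with complex scalars, and so
      does its inverse.\<close>
    moreover have "h' y (c *s w) $ j = c * h' y w $ j" for c w
    proof -
      have "D' (h y) (c *s x) = c *s D' (h y) x" for x
        by (simp add: D'_def vec_eq_iff sum_distrib_left ac_simps)
      moreover have "bij (D' (h y))" "h' y = inv (D' (h y))"
        using bij[OF y] h'[OF y] by (simp_all add: B)
      ultimately have "h' y (c *s w) = c *s h' y w"
        by (simp add: inv_f_eq surj_f_inv_f bij_is_surj bij_is_inj)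
      then show ?thesis by simp
    qed
    ultimately show "\<exists>D. ((\<lambda>y. inv_into U z y $ j) has_derivative D) (at y) \<and>
        (\<forall>c w. D (c *s w) = c * D w)"
      by blast
  qed (fact U)
  then have "centered_coords z U"
    unfolding centered_coords_def holo_map_on_def zU
    using U inj_z z0 polyfun_holo_on[OF pf \<open>open U\<close>] by blast
  then show thesis
    using U that by blast
qed

section \<open>Normal form at a singular point\<close>

text \<open>Splitting off one root at a time lowers the degree by one; after all of \<open>T\<close>
  only a constant remains.\<close>

lemma poly_prod_linear_factors:
  fixes g :: "'a::idom poly"
  assumes "finite T" "degree g \<le> card T" "\<And>s. s \<in> T \<Longrightarrow> poly g s = 0"
  shows "\<exists>c. \<forall>t. poly g t = c * (\<Prod>s\<in>T. t - s)"
  using assms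
proof (induction T arbitrary: g rule: finite_induct)
  case empty
  then have "degree g = 0"
    by simp
  then obtain c where "g = [:c:]"
    by (rule degree_eq_zeroE)
  then show ?case
    by auto
next
  case (insert a T)
  then have "[:- a, 1:] dvd g"
    by (simp add: poly_eq_0_iff_dvd)
  then obtain h where h: "g = [:- a, 1:] * h"
    by (rule dvdE)
  have "degree h \<le> card T"
  proof (cases "h = 0")
    case False
    then have "degree g = 1 + degree h"
      unfolding h by (subst degree_mult_eq) auto
    then show ?thesis
      using insert by simp
  qed simp
  moreover have "poly h s = 0" if "s \<in> T" for s
  proof -
    have "poly g s = (s - a) * poly h s"
      by (simp add: h algebra_simps)
    then show ?thesis
      using insert that by auto
  qed
  ultimately obtain c where c: "\<And>t. poly h t = c * (\<Prod>s\<in>T. t - s)"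
    using insert.IH by blast
  have "poly g t = c * (\<Prod>s\<in>insert a T. t - s)" for t
  proof -
    have "poly g t = (t - a) * poly h t"
      by (simp add: h algebra_simps)
    then show ?thesis
      using insert.hyps by (simp add: c)
  qed
  then show ?case by blast
qed

text \<open>The derivative at \<open>a\<close> is the product of the factors belonging to the other
  elements of \<open>T\<close>, none of which vanishes at \<open>a\<close>.\<close>

lemma simple_zero_prod_linear_factors:
  fixes T :: "complex set"
  assumes "finite T" "a \<in> T"
  obtains m where "((\<lambda>t. \<Prod>s\<in>T. t - s) has_field_derivative m) (at a)" "m \<noteq> 0"
proof
  let ?h = "\<Prod>s\<in>T - {a}. [:- s, 1:]"
  have h: "poly ?h t = (\<Prod>s\<in>T - {a}. t - s)" for t
    by (simp add: poly_prod)
  have "((\<lambda>t. (t - a) * poly ?h t) has_field_derivative poly ?h a) (at a)"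
    by (auto intro!: derivative_eq_intros)
  moreover have "(\<lambda>t. (t - a) * poly ?h t) = (\<lambda>t. \<Prod>s\<in>T. t - s)"
    unfolding h using assms by (simp add: prod.remove[of T a])
  ultimately show "((\<lambda>t. \<Prod>s\<in>T. t - s) has_field_derivative poly ?h a) (at a)"
    by simp
  show "poly ?h a \<noteq> 0"
    unfolding h using assms by simp
qed

text \<open>Dividing by \<open>y $ 2\<close> gives
  \<open>\<phi> y = c * (y $ 3) ^ k + y $ 2 * q y\<close>. On the first axis \<open>q\<close> equals
  \<open>M\<close>, so its first partial derivative at 0 is \<open>m\<close>, which is nonzero.
  Hence \<open>y $ 2\<close>, \<open>q\<close> and \<open>y $ 3\<close> are local
  coordinates.\<close>

lemma A_normal_form:
  fixes \<phi> :: "complex^3 \<Rightarrow> complex"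
  assumes "polyfun \<phi>" "k \<ge> 1" "c \<noteq> 0"
    and slice: "\<And>y. y $ 2 = 0 \<Longrightarrow> \<phi> y = c * (y $ 3) ^ k"
    and deriv: "\<And>t. (\<phi> has_derivative D t) (at (axis 1 t))" "\<And>t. D t (axis 2 1) = M t"
    and M: "M 0 = 0" "(M has_field_derivative m) (at 0)" "m \<noteq> 0"
  obtains U z where "centered_coords z U" "open U"
    "\<And>y. \<phi> y = (z y $ 1)\<^sup>2 + (z y $ 2)\<^sup>2 + (z y $ 3) ^ k"
proof -
  obtain q where q: "polyfun q" and "\<And>y. \<phi> y = \<phi> (\<chi> j. if j = 2 then 0 else y $ j) + y $ 2 * q y"
    using polyfun_split[OF \<open>polyfun \<phi>\<close>] by blast
  then have \<phi>: "\<phi> y = c * (y $ 3) ^ k + y $ 2 * q y" for y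
    by (simp add: slice)
  obtain g where "\<And>i. polyfun (g i)" and g: "\<And>y. (q has_derivative (\<lambda>w. \<Sum>i\<in>UNIV. g i y * w $ i)) (at y)"
    using polyfun_has_derivative[OF q] by blast
  have coord: "((\<lambda>x. x $ i) has_derivative (\<lambda>w. w $ i)) (at y)" for i and y :: "complex^3"
    by (rule bounded_linear_imp_has_derivative) (rule bounded_linear_vec_nth)
  \<comment> \<open>Differentiating the decomposition in direction 2 on the first axis leaves only
    \<open>q\<close>, because \<open>y $ 2\<close> vanishes there and the power of
    \<open>y $ 3\<close> has no derivative in this direction.\<close>
  have qM: "q (axis 1 t) = M t" for t
  proof -
    let ?a = "axis 1 t :: complex^3"
    have "(\<phi> has_derivative (\<lambda>w. c * (of_nat k * w $ 3 * (?a $ 3) ^ (k - 1))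
        + (?a $ 2 * (\<Sum>i\<in>UNIV. g i ?a * w $ i) + w $ 2 * q ?a))) (at ?a)"
      unfolding \<phi>[abs_def]
      by (intro has_derivative_add has_derivative_mult_right has_derivative_mult has_derivative_power coord g)
    from fun_cong[OF has_derivative_unique[OF this deriv(1)], of "axis 2 1"]
    have "D t (axis 2 1) = q ?a"
      by (simp add: axis_def)
    then show ?thesis
      by (simp add: deriv(2))
  qed
  have a0: "axis 1 0 = (0 :: complex^3)"
    by (simp add: axis_def vec_eq_iff)
  have g1: "g 1 0 = m"
  proof -
    have lin: "linear (\<lambda>h. axis 1 h :: complex^3)"
      by (rule linearI) (auto simp: axis_def vec_eq_iff)
    have ax: "((\<lambda>t. axis 1 t :: complex^3) has_derivative (\<lambda>h. axis 1 h)) (at 0)"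
      using lin by (intro bounded_linear_imp_has_derivative) (simp add: linear_conv_bounded_linear)
    from has_derivative_compose[OF ax g]
    have "((\<lambda>t. q (axis 1 t)) has_derivative (\<lambda>h. \<Sum>i\<in>UNIV. g i 0 * axis 1 h $ i)) (at 0)"
      unfolding a0 .
    then have "(M has_derivative (\<lambda>h. \<Sum>i\<in>UNIV. g i 0 * axis 1 h $ i)) (at 0)"
      unfolding qM .
    moreover have "(M has_derivative (\<lambda>h. m * h)) (at 0)"
      using M(2) by (simp add: has_field_derivative_def)
    ultimately have "(\<lambda>h. \<Sum>i\<in>UNIV. g i 0 * axis 1 h $ i) = (\<lambda>h. m * h)"
      by (rule has_derivative_unique)
    from fun_cong[OF this, of 1] show ?thesis
      by (simp add: axis_def sum_3)
  qed
  \<comment> \<open>A \<open>k\<close>-th root of \<open>c\<close>, taken by a complex logarithm,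
    absorbs the constant into the third coordinate.\<close>
  obtain r where r: "r ^ k = c"
  proof
    have "c = exp (Ln c)"
      using \<open>c \<noteq> 0\<close> by simp
    also have "\<dots> = exp (Ln c / of_nat k) ^ k"
      using \<open>k \<ge> 1\<close> by (simp add: exp_of_nat_mult[symmetric])
    finally show "exp (Ln c / of_nat k) ^ k = c" ..
  qed
  have "r \<noteq> 0"
    using r \<open>c \<noteq> 0\<close> \<open>k \<ge> 1\<close> by (metis not_one_le_zero power_0_left)
  \<comment> \<open>The squares of the first two coordinates add up to \<open>y $ 2 * q y\<close>.\<close>
  define z :: "complex^3 \<Rightarrow> complex^3" where
    "z y = vector [1 / 2 * (y $ 2 + q y), \<i> / 2 * (y $ 2 + - 1 * q y), r * y $ 3]" for y
  define E :: "complex^3 \<Rightarrow> complex^3" where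
    "E w = (let dq = \<Sum>i\<in>UNIV. g i 0 * w $ i in
       vector [1 / 2 * (w $ 2 + dq), \<i> / 2 * (w $ 2 + - 1 * dq), r * w $ 3])" for w
  have pf_z: "polyfun (\<lambda>y. z y $ j)" for j
  proof -
    \<comment> \<open>Writing \<open>- 1 * q y\<close> instead of a subtraction keeps the terms
      within the generating rules of \<open>polyfun\<close>.\<close>
    have "polyfun (\<lambda>y. 1 / 2 * (y $ 2 + q y))" "polyfun (\<lambda>y. \<i> / 2 * (y $ 2 + - 1 * q y))"
      "polyfun (\<lambda>y :: complex^3. r * y $ 3)"
      by (intro polyfun.intros q)+
    then show ?thesis
      using exhaust_3[of j] by (elim disjE) (simp_all only: z_def vector_3)
  qed
  have "q 0 = 0"
    using qM[of 0] M(1) unfolding a0 by simp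
  then have "z 0 = 0"
    by (simp add: z_def vec_eq_iff forall_3 vector_3)
  have "(z has_derivative E) (at 0)"
  proof (rule has_derivative_vec)
    fix j :: 3
    have "((\<lambda>y. 1 / 2 * (y $ 2 + q y)) has_derivative
        (\<lambda>w. 1 / 2 * (w $ 2 + (\<Sum>i\<in>UNIV. g i 0 * w $ i)))) (at 0)"
      "((\<lambda>y. \<i> / 2 * (y $ 2 + - 1 * q y)) has_derivative
        (\<lambda>w. \<i> / 2 * (w $ 2 + - 1 * (\<Sum>i\<in>UNIV. g i 0 * w $ i)))) (at 0)"
      "((\<lambda>y. r * y $ 3) has_derivative (\<lambda>w. r * w $ 3)) (at (0 :: complex^3))"
      by (intro has_derivative_mult_right has_derivative_add coord g)+
    then show "((\<lambda>y. z y $ j) has_derivative (\<lambda>w. E w $ j)) (at 0)"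
      using exhaust_3[of j] by (elim disjE) (simp_all only: z_def E_def Let_def vector_3)
  qed
  \<comment> \<open>Sum and difference of the first two components kill \<open>w $ 2\<close> and the
    differential of \<open>q\<close>; with \<open>w $ 3 = 0\<close> the latter is
    \<open>m * w $ 1\<close>.\<close>
  have E0: "w = 0" if "E w = 0" for w
  proof -
    let ?dq = "\<Sum>i\<in>UNIV. g i 0 * w $ i"
    have "w $ 2 + ?dq = 0" "w $ 2 - ?dq = 0" and w3: "w $ 3 = 0"
      using that \<open>r \<noteq> 0\<close> by (auto simp: E_def Let_def vec_eq_iff forall_3 vector_3)
    then have "2 * w $ 2 = 0" "?dq = w $ 2"
      by algebra+
    then have "w $ 2 = 0" "m * w $ 1 = 0"
      by (auto simp: sum_3 g1 w3)
    then show ?thesis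
      using w3 M(3) by (simp add: vec_eq_iff forall_3)
  qed
  obtain U where U: "centered_coords z U" "open U"
    by (rule centered_coords_polyfun[OF pf_z \<open>z 0 = 0\<close> \<open>(z has_derivative E) (at 0)\<close> E0])
  moreover have "\<phi> y = (z y $ 1)\<^sup>2 + (z y $ 2)\<^sup>2 + (z y $ 3) ^ k" for y
    by (simp add: \<phi> z_def vector_3 power_divide power_mult_distrib r power2_eq_square algebra_simps)
  ultimately show thesis
    using that by blast
qed

section \<open>Points of a projective surface\<close>

lemma proj_eq_span:
  assumes "P \<in> proj W"
  obtains v where "v \<noteq> 0" "P = vec.span {v}" "v \<in> W"
proof -
  have P: "vec.subspace P" "vec.dim P = 1" "P \<subseteq> W"
    using assms by (auto simp: proj_def)
  have "\<not> P \<subseteq> {0}"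
    using P(2) vec.dim_eq_0[of P] by auto
  then obtain v where v: "v \<in> P" "v \<noteq> 0"
    by blast
  have "vec.span {v} \<subseteq> P"
    using v P by (intro vec.span_minimal) auto
  then have "vec.span {v} = P"
    using P v by (intro vec.subspace_dim_equal) (auto simp: vec.dim_singleton)
  then show thesis
    using that v P by blast
qed

lemma span_in_proj:
  assumes "vec.subspace W" "v \<in> W" "v \<noteq> 0"
  shows "vec.span {v} \<in> proj W"
  using assms vec.span_minimal[of "{v}" W] by (auto simp: proj_def vec.dim_singleton)

text \<open>\<open>Sing\<close> and \<open>tangent_plane\<close> quantify over all representatives
  of a point; homogeneity reduces both to a single one.\<close>

lemma partial_deriv_homogeneous:
  assumes "form d F"
  shows "poly_eval (partial_deriv i F) (a *s v) = a ^ (d - 1) * poly_eval (partial_deriv i F) v"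
proof (rule poly_eval_homogeneous)
  fix n assume "n \<in> Poly_Mapping.keys (partial_deriv i F)"
  then obtain m where "m \<in> keys F" "Suc (\<Sum>j\<in>UNIV. lookup n j) = (\<Sum>j\<in>UNIV. lookup m j)"
    by (rule degree_partial_deriv)
  then show "(\<Sum>j\<in>UNIV. lookup n j) = d - 1"
    using assms by (auto simp: form_def)
qed

lemma Sing_span_iff:
  assumes "form d F" "vec.span {v} \<in> surface_points F" "v \<noteq> 0"
  shows "vec.span {v} \<in> Sing F \<longleftrightarrow> (\<forall>i. poly_eval (partial_deriv i F) v = 0)"
  using assms vec.span_base[of v "{v}"]
  by (auto simp: Sing_def vec.span_singleton partial_deriv_homogeneous[OF assms(1)])

lemma tangent_plane_span:
  assumes "form d F" "v \<noteq> 0"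
  shows "tangent_plane F (vec.span {v})
    = {w. (\<Sum>i\<in>UNIV. poly_eval (partial_deriv i F) v * w $ i) = 0}"
proof -
  have eq: "(\<Sum>i\<in>UNIV. poly_eval (partial_deriv i F) (a *s v) * w $ i)
      = a ^ (d - 1) * (\<Sum>i\<in>UNIV. poly_eval (partial_deriv i F) v * w $ i)" for a w
    by (simp add: partial_deriv_homogeneous[OF assms(1)] sum_distrib_left ac_simps)
  have "v \<in> vec.span {v} - {0}"
    using assms vec.span_base[of v "{v}"] by auto
  then show ?thesis
    unfolding tangent_plane_def by (auto simp: vec.span_singleton eq)
qed

text \<open>The vertex coordinate is missing from the restricted form, so translation along
  \<open>P\<close> does not change \<open>F\<close> on the tangent plane. As that form is nonzero,
  so is its function.\<close>

lemma star_point_invariant: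
  assumes "star_point d F P"
  shows "P \<subseteq> tangent_plane F P"
    and "\<And>v w. v \<in> P \<Longrightarrow> w \<in> tangent_plane F P \<Longrightarrow> poly_eval F (w + v) = poly_eval F w"
    and "\<exists>w\<in>tangent_plane F P. poly_eval F w \<noteq> 0"
proof -
  obtain b :: "3 \<Rightarrow> complex^4" where b: "vec.span {b 0} = P" "vec.span (range b) = tangent_plane F P"
    "form d (restrict_form b F)" "0 \<notin> vars (restrict_form b F)"
    using assms by (auto simp: star_point_def)
  show "P \<subseteq> tangent_plane F P"
    unfolding b(2)[symmetric] by (subst b(1)[symmetric], intro vec.span_mono) auto
  have in_plane: "(\<Sum>j\<in>UNIV. y $ j *s b j) \<in> tangent_plane F P" for y
    unfolding b(2)[symmetric] by (intro vec.span_sum vec.span_scale vec.span_base) auto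
  show "poly_eval F (w + v) = poly_eval F w" if "v \<in> P" "w \<in> tangent_plane F P" for v w
  proof -
    obtain k where v: "v = k *s b 0"
      using \<open>v \<in> P\<close> b(1) by (auto simp: vec.span_singleton)
    \<comment> \<open>The vertex index \<open>0\<close> of the frame is the last of the indices \<open>1, 2, 3\<close> enumerated by \<open>sum_3\<close>.\<close>
    have three: "(3::3) = 0"
      by simp
    have "range b = {b 1, b 2, b 3}"
      by (simp only: UNIV_3 image_insert image_empty)
    then have "range b = {b 1, b 2, b 0}"
      by (simp only: three)
    then have "w \<in> vec.span {b 1, b 2, b 0}"
      using \<open>w \<in> tangent_plane F P\<close> b(2) by simp
    then obtain y1 y2 y0 where "w - y1 *s b 1 - y2 *s b 2 = y0 *s b 0"
      by (auto simp: vec.span_insert vec.span_singleton)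
    then have w: "w = y1 *s b 1 + y2 *s b 2 + y0 *s b 0"
      by (simp add: algebra_simps)
    define Y :: "complex \<Rightarrow> complex^3" where "Y s = vector [y1, y2, s]" for s
    have Y: "(\<Sum>j\<in>UNIV. Y s $ j *s b j) = y1 *s b 1 + y2 *s b 2 + s *s b 0" for s
      unfolding sum_3 Y_def vector_3 by (simp only: three)
    \<comment> \<open>Adding \<open>v\<close> to \<open>w\<close> changes only the vertex
      coordinate.\<close>
    have "poly_eval (restrict_form b F) (Y (y0 + k)) = poly_eval (restrict_form b F) (Y y0)"
    proof (rule poly_eval_cong_vars)
      fix i assume "i \<in> vars (restrict_form b F)"
      then have "i \<noteq> 3"
        unfolding three using b(4) by blast
      then show "Y (y0 + k) $ i = Y y0 $ i"
        using exhaust_3[of i] by (auto simp: Y_def vector_3)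
    qed
    then have "poly_eval F (y1 *s b 1 + y2 *s b 2 + (y0 + k) *s b 0) = poly_eval F w"
      by (simp add: poly_eval_restrict_form Y w)
    then show ?thesis
      by (simp add: v w algebra_simps)
  qed
  show "\<exists>w\<in>tangent_plane F P. poly_eval F w \<noteq> 0"
  proof (rule ccontr)
    assume "\<not> ?thesis"
    then have "poly_eval (restrict_form b F) y = 0" for y
      using in_plane by (simp add: poly_eval_restrict_form)
    then have "restrict_form b F = 0"
      by (rule poly_eval_eq_0_imp_eq_0)
    then show False
      using b(3) by (simp add: form_def)
  qed
qed

theorem mainTheorem6:
  fixes F :: "4 cpoly" and d :: nat and \<Lambda> :: "(complex^4) set set"
  assumes "d \<ge> 3"
    and "integral_surface d F"
    and "proj_line \<Lambda>"
    and "\<Lambda> \<subseteq> surface_points F"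
    and "\<not> \<Lambda> \<subseteq> Sing F"
    and "\<forall>P \<in> \<Lambda> - Sing F. star_point d F P"
    and "card (Sing F \<inter> \<Lambda>) = d - 1"
  shows "\<forall>P \<in> Sing F \<inter> \<Lambda>. A_singularity (d - 1) F P"
proof

  \<comment> \<open>An affine parameter on the line\<close>
  fix P assume P: "P \<in> Sing F \<inter> \<Lambda>"
  have F: "form d F"
    using assms(2) by (simp add: integral_surface_def)
  obtain W where W: "vec.subspace W" "vec.dim W = 2" "\<Lambda> = proj W"
    using assms(3) by (auto simp: proj_line_def)
  \<comment> \<open>The smooth point \<open>P'\<close> is put at infinity, so every singular point
    of \<Lambda> gets a finite parameter, with \<open>P\<close> at 0.\<close>
  obtain P' where P': "P' \<in> \<Lambda>" "P' \<notin> Sing F"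
    using assms(5) by blast
  obtain p where p: "p \<noteq> 0" "P = vec.span {p}" "p \<in> W"
    using P W(3) proj_eq_span by blast
  obtain p' where p': "p' \<noteq> 0" "P' = vec.span {p'}" "p' \<in> W"
    using P' W(3) proj_eq_span by blast
  have p_notin: "p \<notin> vec.span {p'}"
  proof
    assume "p \<in> vec.span {p'}"
    then have "P \<subseteq> P'"
      unfolding p p' by (simp add: vec.span_minimal)
    then have "P = P'"
      using p p' by (intro vec.subspace_dim_equal) (auto simp: vec.dim_singleton)
    then show False
      using P P' by simp
  qed
  then have indep2: "vec.independent {p, p'}" and "p \<noteq> p'"
    using p'(1) by (auto simp: vec.independent_insert vec.span_base)
  then have "W \<subseteq> vec.span {p, p'}"
    using W(2) p p' by (subst vec.card_eq_dim[symmetric]) auto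
  define pt where "pt t = p + t *s p'" for t
  have pt: "pt t \<noteq> 0" "pt t \<in> W" for t
  proof -
    show "pt t \<in> W"
      unfolding pt_def using W p p' by (intro vec.subspace_add vec.subspace_scale)
    show "pt t \<noteq> 0"
    proof
      assume "pt t = 0"
      then have "p = (- t) *s p'"
        by (simp add: pt_def eq_neg_iff_add_eq_0)
      then show False
        using p_notin vec.span_scale[of p' "{p'}" "- t"] vec.span_base[of p' "{p'}"] by auto
    qed
  qed
  have pt_\<Lambda>: "vec.span {pt t} \<in> \<Lambda>" for t
    unfolding W(3) using W(1) pt(2,1) by (rule span_in_proj)
  define T where "T = {t. vec.span {pt t} \<in> Sing F}"
  have "bij_betw (\<lambda>t. vec.span {pt t}) T (Sing F \<inter> \<Lambda>)"
  proof (rule bij_betw_imageI)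
    show "inj_on (\<lambda>t. vec.span {pt t}) T"
    proof (rule inj_onI)
      fix s t assume "vec.span {pt s} = vec.span {pt t}"
      then have "pt s \<in> vec.span {pt t}"
        using vec.span_base[of "pt s" "{pt s}"] by simp
      then obtain k where "pt s = k *s pt t"
        by (auto simp: vec.span_singleton)
      then have eq: "(1 - k) *s p = (k * t - s) *s p'"
        by (simp add: pt_def algebra_simps vec.scale_left_diff_distrib vec.scale_right_distrib)
      have "k = 1"
      proof (rule ccontr)
        assume "k \<noteq> 1"
        then have "p = (1 / (1 - k)) *s ((1 - k) *s p)"
          unfolding vector_smult_assoc by simp
        also have "\<dots> \<in> vec.span {p'}"
          unfolding eq by (intro vec.span_scale vec.span_base) simp
        finally show False
          using p_notin by simp
      qed
      with eq p'(1) show "s = t"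
        by simp
    qed
    show "(\<lambda>t. vec.span {pt t}) ` T = Sing F \<inter> \<Lambda>"
    proof
      show "(\<lambda>t. vec.span {pt t}) ` T \<subseteq> Sing F \<inter> \<Lambda>"
        using pt_\<Lambda> by (auto simp: T_def)
      show "Sing F \<inter> \<Lambda> \<subseteq> (\<lambda>t. vec.span {pt t}) ` T"
      proof
        fix Q assume Q: "Q \<in> Sing F \<inter> \<Lambda>"
        then obtain v where v: "v \<noteq> 0" "Q = vec.span {v}" "v \<in> W"
          using W(3) proj_eq_span by blast
        then have "v \<in> vec.span {p, p'}"
          using \<open>W \<subseteq> vec.span {p, p'}\<close> by blast
        then obtain a b where "v - a *s p = b *s p'"
          by (auto simp: vec.span_insert vec.span_singleton)
        then have ab: "v = a *s p + b *s p'"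
          by (simp add: algebra_simps)
        \<comment> \<open>Otherwise \<open>Q\<close> would be the smooth point \<open>P'\<close> at
          infinity.\<close>
        have "a \<noteq> 0"
        proof
          assume "a = 0"
          then have "v \<in> P'"
            using ab p' by (simp add: vec.span_base vec.span_scale)
          then have "Q \<subseteq> P'"
            unfolding v p' by (simp add: vec.span_minimal)
          then have "Q = P'"
            using v p' by (intro vec.subspace_dim_equal) (auto simp: vec.dim_singleton)
          then show False
            using Q P' by simp
        qed
        then have v_eq: "v = a *s pt (b / a)"
          by (simp add: ab pt_def vec.scale_right_distrib)
        then have "Q \<subseteq> vec.span {pt (b / a)}"
          unfolding v by (intro vec.span_minimal) (auto simp: vec.span_base vec.span_scale)
        then have "Q = vec.span {pt (b / a)}"
          using v pt by (intro vec.subspace_dim_equal) (auto simp: vec.dim_singleton)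
        then show "Q \<in> (\<lambda>t. vec.span {pt t}) ` T"
          using Q by (auto simp: T_def)
      qed
    qed
  qed
  then have cardT: "card T = d - 1"
    using assms(7) by (simp add: bij_betw_same_card)
  then have finT: "finite T"
    using assms(1) by (intro card_ge_0_finite) simp
  have "0 \<in> T"
    using P p by (simp add: T_def pt_def)

  \<comment> \<open>The gradient along the line\<close>
  have surf: "vec.span {pt t} \<in> surface_points F" for t
    using pt_\<Lambda> assms(4) by blast
  \<comment> \<open>The candidate for the common factor of all partial derivatives on the line, with
    a simple zero at the parameter of each singular point.\<close>
  define M where "M t = (\<Prod>s\<in>T. t - s)" for t
  have M0: "M t = 0 \<longleftrightarrow> t \<in> T" for t
    using finT by (auto simp: M_def)
  \<comment> \<open>On \<open>\<Lambda>\<close> the partials have degree at most \<open>d - 1\<close> and vanish at the \<open>d - 1\<close> points of \<open>T\<close>.\<close>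
  have "\<forall>i. \<exists>c. \<forall>t. poly_eval (partial_deriv i F) (pt t) = c * M t"
  proof
    fix i
    have "(\<Sum>j\<in>UNIV. Poly_Mapping.lookup n j) \<le> card T"
      if n: "n \<in> Poly_Mapping.keys (partial_deriv i F)" for n
    proof -
      obtain m where "m \<in> keys F" "Suc (\<Sum>j\<in>UNIV. lookup n j) = (\<Sum>j\<in>UNIV. lookup m j)"
        using degree_partial_deriv[OF n] .
      then show ?thesis
        using F by (auto simp: form_def cardT)
    qed
    then obtain g where g: "degree g \<le> card T" "\<And>t. poly g t = poly_eval (partial_deriv i F) (pt t)"
      unfolding pt_def using poly_eval_along_line[of "partial_deriv i F" "card T" p p'] by blast
    have "poly g s = 0" if "s \<in> T" for s
      using that Sing_span_iff[OF F surf pt(1)] by (simp add: g T_def)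
    then show "\<exists>c. \<forall>t. poly_eval (partial_deriv i F) (pt t) = c * M t"
      using poly_prod_linear_factors[OF finT g(1)] by (simp add: g M_def)
  qed
  from choice[OF this] obtain c where
    c: "\<And>i t. poly_eval (partial_deriv i F) (pt t) = c i * M t"
    by blast
  \<comment> \<open>The gradient at \<open>pt t\<close> is \<open>M t\<close> times the fixed vector
    \<open>c\<close>, so all smooth points \<open>pt t\<close> share the tangent plane
    \<open>l w = 0\<close>.\<close>
  define l where "l w = (\<Sum>i\<in>UNIV. c i * w $ i)" for w :: "complex^4"
  have l_add: "l (v + w) = l v + l w" and l_scale: "l (a *s v) = a * l v" for v w a
    by (simp_all add: l_def ring_distribs sum.distrib sum_distrib_left ac_simps)
  have star: "star_point d F (vec.span {pt t})" "tangent_plane F (vec.span {pt t}) = {w. l w = 0}"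
    if "t \<notin> T" for t
  proof -
    show "star_point d F (vec.span {pt t})"
      using that pt_\<Lambda> assms(6) by (simp add: T_def)
    have "(\<Sum>i\<in>UNIV. poly_eval (partial_deriv i F) (pt t) * w $ i) = M t * l w" for w
      by (simp add: c l_def sum_distrib_left ac_simps)
    then show "tangent_plane F (vec.span {pt t}) = {w. l w = 0}"
      using that M0 by (simp add: tangent_plane_span[OF F pt(1)])
  qed

  \<comment> \<open>Translation invariance on the common tangent plane\<close>
  obtain t1 where t1: "t1 \<notin> T"
    using finT infinite_UNIV_char_0 ex_new_if_finite by blast
  \<comment> \<open>Each star point gives invariance in its own direction only; two different ones
    span the plane over \<Lambda>.\<close>
  obtain t2 where t2: "t2 \<notin> T" "t2 \<noteq> t1"
    using finT infinite_UNIV_char_0 ex_new_if_finite[of "insert t1 T"] by auto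
  have in_ker: "l (pt t) = 0" if "t \<notin> T" for t
    using star_point_invariant(1)[OF star(1)[OF that]] star(2)[OF that]
      vec.span_base[of "pt t" "{pt t}"] by blast
  have lp': "l p' = 0" and lp: "l p = 0"
  proof -
    have "l p + t1 * l p' = 0" "l p + t2 * l p' = 0"
      using in_ker[OF t1] in_ker[OF t2(1)] by (simp_all add: pt_def l_add l_scale)
    then have "(t2 - t1) * l p' = 0" "l p = - t1 * l p'"
      by algebra+
    then show "l p' = 0" "l p = 0"
      using t2(2) by auto
  qed
  have invariant1: "poly_eval F (w + a *s pt t) = poly_eval F w" if "t \<notin> T" "l w = 0" for w a t
    by (rule star_point_invariant(2)[OF star(1)[OF that(1)]])
      (use that in \<open>auto simp: star(2) vec.span_base vec.span_scale\<close>)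
  have invariant: "poly_eval F (w + (a *s p + b *s p')) = poly_eval F w" if "l w = 0" for w a b
  proof -
    \<comment> \<open>Chosen so that \<open>a *s p + b *s p'\<close> equals
      \<open>(a - \<beta>) *s pt t1 + \<beta> *s pt t2\<close>; comparing coefficients of
      \<open>p'\<close> determines \<open>\<beta>\<close>.\<close>
    define \<beta> where "\<beta> = (b - a * t1) / (t2 - t1)"
    have "(a - \<beta>) * t1 + \<beta> * t2 = a * t1 + \<beta> * (t2 - t1)"
      by (simp add: algebra_simps)
    also have "\<dots> = b"
      using t2(2) by (simp add: \<beta>_def)
    finally have b: "b = (a - \<beta>) * t1 + \<beta> * t2" ..
    have "w + (a *s p + b *s p') = (w + (a - \<beta>) *s pt t1) + \<beta> *s pt t2"
      by (simp add: b pt_def vec_eq_iff algebra_simps)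
    moreover have "l (w + (a - \<beta>) *s pt t1) = 0"
      unfolding l_add l_scale using that in_ker[OF t1] by simp
    ultimately show ?thesis
      by (simp only: invariant1[OF t2(1)] invariant1[OF t1 that])
  qed

  \<comment> \<open>A basis adapted to the line and its tangent plane\<close>
  have "\<exists>i. c i \<noteq> 0"
    using Sing_span_iff[OF F surf pt(1), of t1] t1 by (auto simp: T_def c)
  then obtain i where i: "c i \<noteq> 0" ..
  \<comment> \<open>A vector transversal to the tangent plane, normalised so that the derivative in
    its direction is exactly \<open>M t\<close>.\<close>
  define u :: "complex^4" where "u = axis i (1 / c i)"
  have lu: "l u = 1"
    using i by (simp add: l_def u_def axis_def if_distrib cong: if_cong)
  have "l w = 0" if w: "w \<in> vec.span {p, p'}" for w
  proof -
    obtain a b where "w - a *s p = b *s p'"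
      using w by (auto simp: vec.span_insert vec.span_singleton)
    then have "w = a *s p + b *s p'"
      by (simp add: algebra_simps)
    then show ?thesis
      by (simp add: l_add l_scale lp lp')
  qed
  then have "u \<notin> vec.span {p, p'}"
    using lu by auto
  moreover from this have "u \<notin> {p, p'}"
    using vec.span_base by blast
  ultimately have indep3: "vec.independent {u, p, p'}" and card3: "card {u, p, p'} = 3"
    using indep2 \<open>p \<noteq> p'\<close> by (simp_all add: vec.independent_insert)
  have "vec.span {u, p, p'} \<noteq> UNIV"
  proof
    assume "vec.span {u, p, p'} = UNIV"
    then have "vec.dim (UNIV :: (complex^4) set) = 3"
      using vec.dim_span_eq_card_independent[OF indep3] card3 by simp
    then show False
      by (simp only: vec_dim_card) simp
  qed
  then obtain u0 where u0: "u0 \<notin> vec.span {u, p, p'}"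
    by blast
  \<comment> \<open>Projecting \<open>u0\<close> along \<open>u\<close> moves it into the tangent
    plane without making it dependent on the other three vectors.\<close>
  define u3 where "u3 = u0 - l u0 *s u"
  have lu3: "l u3 = 0"
    using l_add[of u3 "l u0 *s u"] by (simp add: u3_def l_scale lu)
  have "u3 \<notin> vec.span {u, p, p'}"
  proof
    assume "u3 \<in> vec.span {u, p, p'}"
    then have "u3 + l u0 *s u \<in> vec.span {u, p, p'}"
      by (rule vec.span_add) (simp add: vec.span_scale vec.span_base)
    then show False
      using u0 by (simp add: u3_def)
  qed
  then have indep4: "vec.independent {u3, u, p, p'}"
    by (rule vec.independent_insertI[OF _ indep3])
  have "u3 \<notin> {u, p, p'}"
    using \<open>u3 \<notin> vec.span {u, p, p'}\<close> vec.span_base[of u3 "{u, p, p'}"] by blast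
  then have "card {u3, u, p, p'} = Suc (card {u, p, p'})"
    by (intro card_insert_disjoint) simp_all
  also have "\<dots> = vec.dim (UNIV :: (complex^4) set)"
    unfolding vec_dim_card card3 by simp
  finally have "vec.dim (UNIV :: (complex^4) set) \<le> card {u3, u, p, p'}"
    by (rule eq_imp_le[OF sym])
  then have "UNIV \<subseteq> vec.span {u3, u, p, p'}"
    by (rule vec.card_ge_dim_independent[OF subset_UNIV indep4])
  then have spanning: "vec.span {u3, u, p, p'} = UNIV"
    by blast
  define r where "r = poly_eval F u3"
  \<comment> \<open>Invariance removes the directions of \<Lambda>, and homogeneity on the remaining
    direction \<open>u3\<close> gives the \<open>d\<close>-th power.\<close>
  have slice: "poly_eval F (h *s u3 + (a *s p + b *s p')) = r * h ^ d" for h a b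
  proof -
    have "poly_eval F (h *s u3) = h ^ d * r"
      unfolding r_def using F by (intro poly_eval_homogeneous) (simp add: form_def)
    then show ?thesis
      by (simp add: invariant l_scale lu3 mult.commute)
  qed
  \<comment> \<open>If \<open>r\<close> were 0, \<open>F\<close> would vanish on the whole tangent
    plane, contrary to the star condition at \<open>pt t1\<close>.\<close>
  have "r \<noteq> 0"
  proof
    assume "r = 0"
    obtain w where w: "l w = 0" "poly_eval F w \<noteq> 0"
      using star_point_invariant(3)[OF star(1)[OF t1]] star(2)[OF t1] by blast
    have "w \<in> vec.span {u3, u, p, p'}"
      using spanning by simp
    then obtain h e a b where "w - h *s u3 - e *s u - a *s p = b *s p'"
      by (auto simp: vec.span_insert vec.span_singleton)
    then have "w = h *s u3 + e *s u + a *s p + b *s p'"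
      by (simp add: algebra_simps)
    moreover from this have "e = 0"
      using w(1) by (simp add: l_add l_scale lu lu3 lp lp')
    ultimately have "poly_eval F w = r * h ^ d"
      using slice by (simp add: add.assoc)
    then show False
      using w(2) \<open>r = 0\<close> by simp
  qed

  \<comment> \<open>The affine chart at the singular point\<close>
  define b :: "3 \<Rightarrow> complex^4" where "b j = (if j = 1 then p' else if j = 2 then u else u3)" for j
  define \<phi> where "\<phi> y = poly_eval F (p + (\<Sum>j\<in>UNIV. y $ j *s b j))" for y
  \<comment> \<open>The coordinates run along \<Lambda>, across the tangent plane, and within that
    plane away from \<Lambda>, in the order \<open>A_normal_form\<close> expects.\<close>
  have chart: "(\<Sum>j\<in>UNIV. y $ j *s b j) = y $ 1 *s p' + y $ 2 *s u + y $ 3 *s u3" for y :: "complex^3"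
    by (simp add: sum_3 b_def)
  have "polyfun \<phi>"
    unfolding \<phi>_def
    by (rule polyfun_poly_eval) (auto simp: chart intro!: polyfun.intros)
  have \<phi>_slice: "\<phi> y = r * (y $ 3) ^ d" if "y $ 2 = 0" for y
    using slice[of "y $ 3" 1 "y $ 1"] that by (simp add: \<phi>_def chart algebra_simps)
  define D where "D t w = (\<Sum>i\<in>UNIV. poly_eval (partial_deriv i F) (pt t) *
      (\<Sum>j\<in>UNIV. w $ j *s b j) $ i)" for t and w :: "complex^3"
  have D: "(\<phi> has_derivative D t) (at (axis 1 t))" for t
  proof -
    let ?L = "\<lambda>y :: complex^3. \<Sum>j\<in>UNIV. y $ j *s b j"
    have "linear ?L"
      unfolding chart by (rule linearI) (simp_all add: vec_eq_iff algebra_simps)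
    then have "(?L has_derivative ?L) (at (axis 1 t))"
      by (intro bounded_linear_imp_has_derivative) (simp add: linear_conv_bounded_linear)
    then have "((\<lambda>y. p + ?L y) has_derivative ?L) (at (axis 1 t))"
      using has_derivative_add[OF has_derivative_const] by fastforce
    moreover have "p + ?L (axis 1 t) = pt t"
      unfolding chart by (simp add: axis_def pt_def)
    ultimately show ?thesis
      using has_derivative_compose[OF _ has_derivative_poly_eval[of F], of "\<lambda>y. p + ?L y" ?L "axis 1 t"]
      by (simp add: \<phi>_def[abs_def] D_def[abs_def])
  qed
  have DM: "D t (axis 2 1) = M t" for t
  proof -
    have "D t (axis 2 1) = M t * l u"
      unfolding D_def chart by (simp add: c l_def axis_def sum_distrib_left ac_simps)
    then show ?thesis
      by (simp add: lu)
  qed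
  \<comment> \<open>\<open>P\<close> has parameter 0, where \<open>M\<close> has a simple
    zero.\<close>
  obtain m where m: "(M has_field_derivative m) (at 0)" "m \<noteq> 0"
    using simple_zero_prod_linear_factors[OF finT \<open>0 \<in> T\<close>] unfolding M_def[abs_def] by blast
  have "1 \<le> d" "M 0 = 0"
    using assms(1) M0 \<open>0 \<in> T\<close> by simp_all
  from A_normal_form[OF \<open>polyfun \<phi>\<close> this(1) \<open>r \<noteq> 0\<close> \<phi>_slice D DM this(2) m]
  obtain U z where Uz: "centered_coords z U" "open U"
    "\<And>y. \<phi> y = (z y $ 1)\<^sup>2 + (z y $ 2)\<^sup>2 + (z y $ 3) ^ d"
    by metis
  have "range b = {p', u, u3}"
    unfolding UNIV_3 by (simp add: b_def insert_commute)
  then have "vec.span (insert p (range b)) = UNIV"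
    using spanning by (simp add: insert_commute)
  \<comment> \<open>The normal form holds exactly, so the nowhere vanishing factor is 1.\<close>
  moreover have "holo_on (\<lambda>y. 1) U"
    using polyfun.const Uz(2) by (rule polyfun_holo_on)
  moreover have "P \<in> surface_points F"
    using P by (simp add: Sing_def)
  \<comment> \<open>Index \<open>d - 1\<close> in \<open>A_singularity\<close> stands for the
    exponent \<open>d - 1 + 1\<close>, which is \<open>d\<close>.\<close>
  moreover have "d - 1 \<ge> 1" "d - 1 + 1 = d"
    using assms(1) by auto
  ultimately show "A_singularity (d - 1) F P"
    unfolding A_singularity_def
    using Uz p(2)
    by (intro conjI exI[of _ p] exI[of _ b] exI[of _ U] exI[of _ z] exI[of _ "\<lambda>y. 1"])
      (simp_all add: \<phi>_def[symmetric])
qed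
end
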